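(* Let $m\ge2$ be an even integer, and let $\tilde z$ be an $m$-closed discrete holomorphic function (in rotated coordinates) such that $\tilde z_{i,0}=0$ for all $i\in2\mathbb Z$, and such that $$\sum_{i=0}^{m-1}(-1)^i\frac{1}{\tilde z_{2i+1,1}}=0 .$$ Assume that the propagation map $T$ can be applied to $(\tilde z_0,\tilde z_1)$ at least $2m-4$ times. Then, for all $i\in2\mathbb Z+1$, $$\tilde z_{i,2m-3}=\Bigl(\frac1m\sum_{\ell=0}^{m-1}\frac{1}{\tilde z_{2\ell+1,1}}\Bigr)^{-1}.$$ In other words, $\tilde z_{2m-3}$ is constant with value equal to the harmonic mean of $\tilde z_1$.
   Context: $\hat{\mathbb C}=\mathbb C\cup\{\infty\}$ is identified with $\mathbb{CP}^1$. A discrete holomorphic function is a map $z$ to $\hat{\mathbb C}$ such that on every quad $\frac{(z_{i,j}-z_{i+1,j})(z_{i+1,j+1}-z_{i,j+1})}{(z_{i+1,j}-z_{i+1,j+1})(z_{i,j+1}-z_{i,j})}=-1$. Rotated coordinates: $z_{i,j}=\tilde z_{i-j,i+j}$, so $\tilde z_{i,j}$ is defined for $i+j$ even, and $\tilde z_j=(\tilde z_{i,j})_{i\equiv j\bmod 2}$. The relation determines $\tilde z_{j+2}$ from $(\tilde z_j,\tilde z_{j+1})$; the propagation map is $T:(\tilde z_j,\tilde z_{j+1})\mapsto(\tilde z_{j+1},\tilde z_{j+2})$. $z$ is $m$-closed if $z_{i+m,j-m}=z_{i,j}$ for all $i,j$, equivalently $\tilde z_{i+2m,j}=\tilde z_{i,j}$.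 Since $\tilde z_0$ is constant, backward propagation is undefined; $z$ is considered on $\{i+j\ge0\}$, obtained from $(\tilde z_0,\tilde z_1)$ by forward propagation. "$T$ can be applied" means that at each step the new values are well defined; standing assumption: the data are as generic as possible given the stated constraints. *)

theory Defs
  imports Complex_Main
begin

datatype csphere = Fin (fin_part: complex) | Infty

fun inv_hat :: "csphere \<Rightarrow> csphere" where
  "inv_hat (Fin z) = (if z = 0 then Infty else Fin (1 / z))"
| "inv_hat Infty = Fin 0"

text \<open>Homogeneous coordinates on \<open>CP^1\<close>, and the \<open>2 \<times> 2\<close> determinant of two points, which is the
  difference of the points when both are finite. In the cross-ratio below each point occurs once in
  the numerator and once in the denominator, so the value does not depend on the chosen
  representatives; factors involving \<open>\<infinity>\<close> cancel in the usual way.\<close>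

fun hom_coords :: "csphere \<Rightarrow> complex \<times> complex" where
  "hom_coords (Fin z) = (z, 1)"
| "hom_coords Infty = (1, 0)"

definition bracket :: "csphere \<Rightarrow> csphere \<Rightarrow> complex" where
  "bracket p q = fst (hom_coords p) * snd (hom_coords q) - snd (hom_coords p) * fst (hom_coords q)"

text \<open>Arguments are the corners of a quad in cyclic order. When the denominator vanishes, the value
  is 0 by the convention for division; hence cross-ratio \<open>-1\<close> forces all four points to be
  distinct.\<close>

definition cross_ratio :: "csphere \<Rightarrow> csphere \<Rightarrow> csphere \<Rightarrow> csphere \<Rightarrow> complex" where
  "cross_ratio a b c d = (bracket a b * bracket c d) / (bracket b c * bracket d a)"

lemma cross_ratio_Fin:
  "cross_ratio (Fin a) (Fin b) (Fin c) (Fin d) = ((a - b) * (c - d)) / ((b - c) * (d - a))"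
  by (simp add: cross_ratio_def bracket_def)

definition discrete_holomorphic_on :: "(int \<times> int) set \<Rightarrow> (int \<Rightarrow> int \<Rightarrow> csphere) \<Rightarrow> bool" where
  "discrete_holomorphic_on D z \<longleftrightarrow>
     (\<forall>i j. {(i, j), (i + 1, j), (i + 1, j + 1), (i, j + 1)} \<subseteq> D \<longrightarrow>
        cross_ratio (z i j) (z (i + 1) j) (z (i + 1) (j + 1)) (z i (j + 1)) = -1)"

definition closed_on :: "(int \<times> int) set \<Rightarrow> nat \<Rightarrow> (int \<Rightarrow> int \<Rightarrow> csphere) \<Rightarrow> bool" where
  "closed_on D m z \<longleftrightarrow> (\<forall>(i, j) \<in> D. z (i + int m) (j - int m) = z i j)"

text \<open>The part of the half-plane \<open>i + j \<ge> 0\<close> filled by the two initial layers and \<open>n\<close> propagation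
  steps. (Propagation need not be possible indefinitely: a constant layer admits no successor with
  cross-ratio \<open>-1\<close>.)\<close>

definition strip :: "nat \<Rightarrow> (int \<times> int) set" where
  "strip n = {(i, j). 0 \<le> i + j \<and> i + j \<le> int n + 1}"

text \<open>Rotated coordinates; meaningful only for even \<open>i + j\<close>.\<close>

definition rotated :: "(int \<Rightarrow> int \<Rightarrow> csphere) \<Rightarrow> int \<Rightarrow> int \<Rightarrow> csphere" where
  "rotated z i j = z ((i + j) div 2) ((j - i) div 2)"

lemma rotated_diff_sum: "rotated z (i - j) (i + j) = z i j"
  by (simp add: rotated_def)

text \<open>A layer is a partial map whose domain is one parity class of the integers.\<close>

type_synonym layer = "int \<rightharpoonup> csphere"

definition layer_of :: "(int \<Rightarrow> int \<Rightarrow> csphere) \<Rightarrow> int \<Rightarrow> layer" where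
  "layer_of z j = (\<lambda>i. if even (i + j) then Some (rotated z i j) else None)"

text \<open>With \<open>u\<close>, \<open>v\<close> the layers \<open>j\<close>, \<open>j + 1\<close>, the quad with lowest corner \<open>(i, j)\<close> (in rotated
  coordinates) has corners \<open>(i, j)\<close>, \<open>(i + 1, j + 1)\<close>, \<open>(i, j + 2)\<close>, \<open>(i - 1, j + 1)\<close> in cyclic order;
  \<open>w\<close> is the new value.\<close>

definition new_value :: "layer \<Rightarrow> layer \<Rightarrow> int \<Rightarrow> csphere \<Rightarrow> bool" where
  "new_value u v i w \<longleftrightarrow>
     cross_ratio (the (u i)) (the (v (i + 1))) w (the (v (i - 1))) = -1"

definition propagation :: "layer \<times> layer \<rightharpoonup> layer \<times> layer" where
  "propagation = (\<lambda>(u, v).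
     if \<forall>i \<in> dom u. \<exists>!w. new_value u v i w
     then Some (v, \<lambda>i. if i \<in> dom u then Some (THE w. new_value u v i w) else None)
     else None)"

primrec propagation_iter :: "nat \<Rightarrow> layer \<times> layer \<rightharpoonup> layer \<times> layer" where
  "propagation_iter 0 s = Some s"
| "propagation_iter (Suc n) s = Option.bind (propagation_iter n s) propagation"

definition propagation_applicable :: "nat \<Rightarrow> layer \<times> layer \<Rightarrow> bool" where
  "propagation_applicable n s \<longleftrightarrow> propagation_iter n s \<noteq> None"

end

theory Submission
  imports Defs "HOL-Computational_Algebra.Polynomial"
begin

text \<open>The cross-ratio equation is the flatness condition of a connection with spectral parameter
  \<open>\<mu>\<close>: transport along an edge from \<open>u\<close> to \<open>v\<close> is \<open>I \<mp> \<mu> P\<close>, where \<open>P\<close> is the projection onto the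
  line \<open>v\<close> along the line \<open>u\<close>. When the bottom layer is constant and the data are periodic, there is
  a flat section \<open>g\<close>, polynomial in \<open>\<mu>\<close>, which is explicit on the bottom layer. Its value at \<open>\<mu> = 0\<close> is
  the same vector \<open>(m, \<Sum> 1/z)\<close> at all vertices. On the bottom layer the polynomial \<open>[v, g\<^sub>v]\<close> has
  degree at most \<open>m - 2\<close>, by the alternating sum condition; this degree drops by one every second
  layer, so that \<open>[v, g\<^sub>v] = 0\<close> on layer \<open>2 m - 3\<close>. Setting \<open>\<mu> = 0\<close> identifies \<open>v\<close> with the point
  \<open>(m, \<Sum> 1/z)\<close>.\<close>

section \<open>Polynomial vectors and their transport along edges\<close>

definition poly_bracket :: "csphere \<Rightarrow> complex poly \<times> complex poly \<Rightarrow> complex poly" where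
  "poly_bracket p g = smult (fst (hom_coords p)) (snd g) - smult (snd (hom_coords p)) (fst g)"

text \<open>Equivalent to \<open>(I - (1 - t) P) g\<^sub>u = t g\<^sub>v\<close> with \<open>P\<close> as above.\<close>

definition transported ::
  "complex poly \<Rightarrow> csphere \<Rightarrow> csphere \<Rightarrow> complex poly \<times> complex poly \<Rightarrow> complex poly \<times> complex poly \<Rightarrow> bool"
  where "transported t u v gu gv \<longleftrightarrow>
    poly_bracket v gu = t * poly_bracket v gv \<and> poly_bracket u gu = poly_bracket u gv"

lemma poly_poly_bracket:
  "poly (poly_bracket p g) x =
    fst (hom_coords p) * poly (snd g) x - snd (hom_coords p) * poly (fst g) x"
  by (simp add: poly_bracket_def)

lemma transportedD:
  assumes "transported t u v gu gv" "hom_coords u = (u1, u2)" "hom_coords v = (v1, v2)"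
  shows "v1 * poly (snd gu) x - v2 * poly (fst gu) x =
      poly t x * (v1 * poly (snd gv) x - v2 * poly (fst gv) x)"
    and "u1 * poly (snd gu) x - u2 * poly (fst gu) x = u1 * poly (snd gv) x - u2 * poly (fst gv) x"
proof -
  have "poly (poly_bracket v gu) x = poly t x * poly (poly_bracket v gv) x"
    "poly (poly_bracket u gu) x = poly (poly_bracket u gv) x"
    using assms(1) by (simp_all add: transported_def)
  then show "v1 * poly (snd gu) x - v2 * poly (fst gu) x =
      poly t x * (v1 * poly (snd gv) x - v2 * poly (fst gv) x)"
    "u1 * poly (snd gu) x - u2 * poly (fst gu) x = u1 * poly (snd gv) x - u2 * poly (fst gv) x"
    by (simp_all add: poly_poly_bracket assms)
qed

text \<open>The disjunct \<open>p = 0\<close> matters only for \<open>n = 0\<close>: there the bound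
  says \<open>p = 0\<close>, which is the form in which it is used on the last layer.\<close>

definition degree_less :: "nat \<Rightarrow> 'a::zero poly \<Rightarrow> bool" where
  "degree_less n p \<longleftrightarrow> p = 0 \<or> degree p < n"

lemma degree_less_iff_coeff: "degree_less n p \<longleftrightarrow> (\<forall>k\<ge>n. coeff p k = 0)"
proof
  assume "\<forall>k\<ge>n. coeff p k = 0"
  then show "degree_less n p"
    unfolding degree_less_def by (metis leading_coeff_0_iff linorder_not_less)
qed (auto simp: degree_less_def coeff_eq_0)

lemma degree_less_add: "degree_less n p \<Longrightarrow> degree_less n q \<Longrightarrow> degree_less n (p + q)"
  for p q :: "'a::comm_monoid_add poly"
  by (simp add: degree_less_iff_coeff)

lemma degree_less_diff: "degree_less n p \<Longrightarrow> degree_less n q \<Longrightarrow> degree_less n (p - q)"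
  for p q :: "'a::ab_group_add poly"
  by (simp add: degree_less_iff_coeff)

lemma degree_less_smult: "degree_less n p \<Longrightarrow> degree_less n (smult c p)"
  for p :: "'a::comm_semiring_0 poly"
  by (simp add: degree_less_iff_coeff)

lemma degree_less_mono: "degree_less n p \<Longrightarrow> n \<le> k \<Longrightarrow> degree_less k p"
  by (auto simp: degree_less_def)

lemma degree_less_cancel_mult:
  fixes p q :: "'a::idom poly"
  assumes "degree_less n (q * p)" "degree q = 1"
  shows "degree_less (n - 1) p"
proof (cases "p = 0")
  case False
  with assms have "degree (q * p) = Suc (degree p)"
    by (metis degree_0 degree_mult_eq plus_1_eq_Suc zero_neq_one)
  then show ?thesis using assms(1) by (auto simp: degree_less_def)
qed (simp add: degree_less_def)

section \<open>Flatness and degree drop on a single quad\<close>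

lemma cross_ratio_minus_one:
  assumes "cross_ratio a b c d = -1"
  shows "bracket a b * bracket c d = - (bracket b c * bracket d a)"
    and "bracket a d \<noteq> 0" "bracket b d \<noteq> 0"
proof -
  have nz: "bracket b c * bracket d a \<noteq> 0"
    using assms by (auto simp: cross_ratio_def)
  show eq: "bracket a b * bracket c d = - (bracket b c * bracket d a)"
    using assms nz by (simp add: cross_ratio_def divide_eq_eq)
  have anti: "bracket p q = - bracket q p" for p q by (simp add: bracket_def)
  show "bracket a d \<noteq> 0" using nz anti[of a d] by auto
  show "bracket b d \<noteq> 0"
  proof
    assume bd: "bracket b d = 0"
    \<comment> \<open>Pluecker relation; with \<open>bracket b d = 0\<close> it would make the
      cross-ratio 1.\<close>
    have "bracket a b * bracket c d + bracket b c * bracket a d = bracket b d * bracket a c"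
      by (simp add: bracket_def algebra_simps)
    then have "bracket b c * bracket a d = - (bracket a b * bracket c d)"
      using bd by (simp add: add_eq_0_iff)
    with eq anti[of a d] nz show False by simp
  qed
qed

text \<open>Opposite edges carry the same factor. Since \<open>b\<close> and \<open>d\<close>
  differ, the brackets preserved along the two upper edges determine \<open>gc\<close>. The
  remaining two conditions hold because \<open>c\<close> is the harmonic conjugate of
  \<open>a\<close> with respect to \<open>b\<close>, \<open>d\<close>, together with
  \<open>t + t' = 2\<close>.\<close>

lemma transported_quad:
  assumes cr: "cross_ratio a b c d = -1"
    and t: "t + t' = 2"
    and ab: "transported t a b ga gb" and ad: "transported t' a d ga gd"
    and b0: "poly (fst gb) 0 = x0" "poly (snd gb) 0 = y0"
    and d0: "poly (fst gd) 0 = x0" "poly (snd gd) 0 = y0"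
  obtains gc where "transported t' b c gb gc" "transported t d c gd gc"
    "poly (fst gc) 0 = x0" "poly (snd gc) 0 = y0"
proof -
  obtain a1 a2 where a: "hom_coords a = (a1, a2)" by fastforce
  obtain b1 b2 where b: "hom_coords b = (b1, b2)" by fastforce
  obtain c1 c2 where c: "hom_coords c = (c1, c2)" by fastforce
  obtain d1 d2 where d: "hom_coords d = (d1, d2)" by fastforce
  define e where "e = bracket b d"
  have e: "e = b1 * d2 - b2 * d1" by (simp add: e_def bracket_def b d)
  have ad0: "a1 * d2 - a2 * d1 \<noteq> 0" and e0: "e \<noteq> 0"
    using cross_ratio_minus_one[OF cr] by (auto simp: bracket_def a b d e_def)
  have rel: "(a1 * b2 - a2 * b1) * (c1 * d2 - c2 * d1) = - ((b1 * c2 - b2 * c1) * (d1 * a2 - d2 * a1))"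
    using cross_ratio_minus_one(1)[OF cr] by (simp add: bracket_def a b c d)
  \<comment> \<open>Cramer's rule for the vector with prescribed brackets with \<open>b\<close> and
    \<open>d\<close>.\<close>
  define gc where "gc =
    (smult (1 / e) (smult d1 (poly_bracket b gb) - smult b1 (poly_bracket d gd)),
     smult (1 / e) (smult d2 (poly_bracket b gb) - smult b2 (poly_bracket d gd)))"
  have gc: "e * poly (fst gc) x = d1 * poly (poly_bracket b gb) x - b1 * poly (poly_bracket d gd) x"
    "e * poly (snd gc) x = d2 * poly (poly_bracket b gb) x - b2 * poly (poly_bracket d gd) x" for x
    using e0 by (simp_all add: gc_def)
  have bc: "poly_bracket b gc = poly_bracket b gb" and dc: "poly_bracket d gc = poly_bracket d gd"
  proof -
    have "e * poly (poly_bracket b gc) x = e * poly (poly_bracket b gb) x" for x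
      using gc[of x] e by (simp add: poly_poly_bracket b d) algebra
    then show "poly_bracket b gc = poly_bracket b gb"
      using e0 by (simp add: poly_eq_poly_eq_iff[symmetric] fun_eq_iff)
    have "e * poly (poly_bracket d gc) x = e * poly (poly_bracket d gd) x" for x
      using gc[of x] e by (simp add: poly_poly_bracket b d) algebra
    then show "poly_bracket d gc = poly_bracket d gd"
      using e0 by (simp add: poly_eq_poly_eq_iff[symmetric] fun_eq_iff)
  qed
  have main: "poly (poly_bracket c gb) x = poly t' x * poly (poly_bracket c gc) x \<and>
      poly (poly_bracket c gd) x = poly t x * poly (poly_bracket c gc) x" for x
  proof -
    obtain p q where p: "p = poly (fst gb) x" and q: "q = poly (snd gb) x" by blast
    obtain r s where r: "r = poly (fst gd) x" and s: "s = poly (snd gd) x" by blast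
    obtain u v where u: "u = poly (fst ga) x" and v: "v = poly (snd ga) x" by blast
    obtain X Y where X: "X = poly (fst gc) x" and Y: "Y = poly (snd gc) x" by blast
    obtain T T' where T: "T = poly t x" and T': "T' = poly t' x" by blast
    have TT: "T + T' = 2" using arg_cong[OF t, of "\<lambda>p. poly p x"] by (simp add: T T')
    have 1: "b1 * v - b2 * u = T * (b1 * q - b2 * p)" "a1 * v - a2 * u = a1 * q - a2 * p"
      using transportedD[OF ab a b, of x] by (simp_all add: p q u v T)
    have 2: "d1 * v - d2 * u = T' * (d1 * s - d2 * r)" "a1 * v - a2 * u = a1 * s - a2 * r"
      using transportedD[OF ad a d, of x] by (simp_all add: r s u v T')
    have 3: "b1 * Y - b2 * X = b1 * q - b2 * p"  "d1 * Y - d2 * X = d1 * s - d2 * r"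
      using arg_cong[OF bc, of "\<lambda>p. poly p x"] arg_cong[OF dc, of "\<lambda>p. poly p x"]
      by (auto simp: poly_poly_bracket b d p q r s X Y)
    \<comment> \<open>In the basis \<open>b\<close>, \<open>d\<close> the coordinates of
      \<open>c\<close> are \<open>k\<close> times those of \<open>a\<close> with the sign at
      \<open>d\<close> flipped.\<close>
    define k where "k = (c1 * d2 - c2 * d1) / (a1 * d2 - a2 * d1)"
    have k1: "c1 * d2 - c2 * d1 = k * (a1 * d2 - a2 * d1)"
      using ad0 by (simp add: k_def)
    have k2: "b1 * c2 - b2 * c1 = k * (a1 * b2 - a2 * b1)"
    proof -
      have "(b1 * c2 - b2 * c1 - k * (a1 * b2 - a2 * b1)) * (a1 * d2 - a2 * d1) = 0"
        using rel k1 by algebra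
      then show ?thesis using ad0 by simp
    qed
    define Nb Nd where "Nb = b1 * q - b2 * p" and "Nd = d1 * s - d2 * r"
    have c_eq: "e * c1 = k * ((a1 * d2 - a2 * d1) * b1 + (a1 * b2 - a2 * b1) * d1)"
      "e * c2 = k * ((a1 * d2 - a2 * d1) * b2 + (a1 * b2 - a2 * b1) * d2)"
      using k1 k2 e by algebra+
    have a_eq: "e * a1 = (a1 * d2 - a2 * d1) * b1 - (a1 * b2 - a2 * b1) * d1"
      "e * a2 = (a1 * d2 - a2 * d1) * b2 - (a1 * b2 - a2 * b1) * d2"
      using e by algebra+
    have Na: "e * (a1 * v - a2 * u) = (a1 * d2 - a2 * d1) * T * Nb - (a1 * b2 - a2 * b1) * T' * Nd"
      using a_eq 1(1) 2(1) unfolding Nb_def Nd_def by algebra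
    have Nc: "e * (c1 * Y - c2 * X) = k * ((a1 * d2 - a2 * d1) * Nb + (a1 * b2 - a2 * b1) * Nd)"
      using c_eq 3 unfolding Nb_def Nd_def by algebra
    \<comment> \<open>Eliminating \<open>d\<close> from the expansions of \<open>a\<close> and
      \<open>c\<close> leaves \<open>b\<close> and \<open>a\<close>, so the bracket with
      \<open>a\<close> that \<open>gb\<close> shares with \<open>ga\<close> can be used; the next
      step eliminates \<open>b\<close> in the same way.\<close>
    have cb: "e * (c1 * q - c2 * p) = k * (2 * (a1 * d2 - a2 * d1) * Nb - e * (a1 * v - a2 * u))"
      using c_eq a_eq 1(2) unfolding Nb_def by algebra
    have cd: "e * (c1 * s - c2 * r) = k * (2 * (a1 * b2 - a2 * b1) * Nd + e * (a1 * v - a2 * u))"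
      using c_eq a_eq 2(2) unfolding Nd_def by algebra
    have "e * (c1 * q - c2 * p) = e * (T' * (c1 * Y - c2 * X))"
      using cb Na Nc TT by algebra
    moreover have "e * (c1 * s - c2 * r) = e * (T * (c1 * Y - c2 * X))"
      using cd Na Nc TT by algebra
    ultimately show ?thesis
      using e0 by (simp add: poly_poly_bracket c p q r s X Y T T')
  qed
  show ?thesis
  proof
    show "transported t' b c gb gc" "transported t d c gd gc"
      using main bc dc unfolding transported_def
      by (simp_all add: poly_eq_poly_eq_iff[symmetric] fun_eq_iff)
    \<comment> \<open>At 0 both neighbours carry the same vector, and Cramer's rule returns
      it.\<close>
    have "e * poly (fst gc) 0 = e * x0" "e * poly (snd gc) 0 = e * y0"
      using gc[of 0, unfolded poly_poly_bracket b d fst_conv snd_conv b0 d0] e by algebra+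
    then show "poly (fst gc) 0 = x0" "poly (snd gc) 0 = y0" using e0 by simp_all
  qed
qed

text \<open>By the Pluecker relation \<open>poly_bracket c gd\<close> is a combination of the
  brackets at \<open>a\<close> and \<open>d\<close>, so it obeys their bound. It also equals
  \<open>t * poly_bracket c gc\<close>, and cancelling the linear factor \<open>t\<close> gains one
  degree.\<close>

lemma degree_less_quad:
  assumes cr: "cross_ratio a b c d = -1" and t: "degree t = 1"
    and ad: "transported t' a d ga gd" and dc: "transported t d c gd gc"
    and "degree_less n (poly_bracket a ga)" "degree_less n (poly_bracket d gd)"
  shows "degree_less (n - 1) (poly_bracket c gc)"
proof -
  have e: "bracket a d \<noteq> 0" using cross_ratio_minus_one[OF cr] by simp
  have "smult (bracket a d) (poly_bracket c gd) =
      smult (bracket c d) (poly_bracket a gd) + smult (bracket a c) (poly_bracket d gd)"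
    by (simp add: poly_eq_poly_eq_iff[symmetric] fun_eq_iff poly_poly_bracket bracket_def algebra_simps)
  also have "poly_bracket a gd = poly_bracket a ga" using ad by (simp add: transported_def)
  also have "degree_less n (smult (bracket c d) (poly_bracket a ga) +
      smult (bracket a c) (poly_bracket d gd))"
    using assms by (intro degree_less_add degree_less_smult)
  finally have "degree_less n (poly_bracket c gd)" using e by (simp add: degree_less_def)
  then show ?thesis using dc t degree_less_cancel_mult by (simp add: transported_def)
qed

section \<open>Generating functions of periodic sequences\<close>

lemma sum_shift_periodic:
  fixes f :: "int \<Rightarrow> 'a::ab_group_add"
  assumes "\<And>k. f (k + int m) = f k"
  shows "(\<Sum>l<m. f (k + int l)) = (\<Sum>l<m. f (int l))"
proof -
  have step: "(\<Sum>l<m. f (k + 1 + int l)) = (\<Sum>l<m. f (k + int l))" for k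
  proof -
    have "f k + (\<Sum>l<m. f (k + 1 + int l)) = (\<Sum>l<Suc m. f (k + int l))"
      by (subst sum.lessThan_Suc_shift) (simp add: ac_simps)
    also have "\<dots> = f k + (\<Sum>l<m. f (k + int l))" using assms[of k] by simp
    finally show ?thesis by simp
  qed
  show ?thesis
  proof (induction k rule: int_induct[where k = 0])
    case (step2 i)
    then show ?case using step[of "i - 1"] by simp
  qed (simp_all add: step)
qed

text \<open>Telescoping: after multiplication by \<open>a\<close> and \<open>b\<close> the two sums
  share all terms except the first and the last, whose coefficients agree by periodicity.\<close>

lemma homogeneous_sum_recurrence:
  fixes a b :: "'a::comm_ring_1 poly" and w :: "int \<Rightarrow> 'a"
  assumes "w (k + int m) = w k"
  shows "a * (\<Sum>l<m. smult (w (k + int l)) (a ^ (m - 1 - l) * b ^ l)) -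
      b * (\<Sum>l<m. smult (w (k + 1 + int l)) (a ^ (m - 1 - l) * b ^ l)) =
    smult (w k) (a ^ m - b ^ m)"
proof -
  let ?f = "\<lambda>l. smult (w (k + int l)) (a ^ (m - l) * b ^ l)"
  have "a * (\<Sum>l<m. smult (w (k + int l)) (a ^ (m - 1 - l) * b ^ l)) = (\<Sum>l<m. ?f l)"
    unfolding sum_distrib_left
    by (rule sum.cong) (auto simp: mult.assoc[symmetric] power_Suc[symmetric] Suc_diff_Suc
        simp del: power_Suc)
  moreover have "b * (\<Sum>l<m. smult (w (k + 1 + int l)) (a ^ (m - 1 - l) * b ^ l)) =
      (\<Sum>l<m. ?f (Suc l))"
    unfolding sum_distrib_left by (rule sum.cong) (auto simp: ac_simps)
  moreover have "(\<Sum>l<m. ?f l) + ?f m = ?f 0 + (\<Sum>l<m. ?f (Suc l))"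
    using sum.lessThan_Suc_shift[of ?f m] by simp
  ultimately show ?thesis
    using assms by (simp add: algebra_simps smult_diff_right)
qed

text \<open>Transport factors 1 + \<mu> and 1 - \<mu>: \<open>up\<close> belongs to edges in the
  second coordinate direction, \<open>dn\<close> to those in the first.\<close>

abbreviation up :: "complex poly" where "up \<equiv> [:1, 1:]"
abbreviation dn :: "complex poly" where "dn \<equiv> [:1, -1:]"

text \<open>The generating function \<open>\<Sum>\<^sub>l w (k + l) s\<^sup>l\<close>, \<open>s = (1 - \<mu>) / (1 + \<mu>)\<close>, over one period and
  cleared of denominators; for \<open>w = 1\<close> it is \<open>((1 + \<mu>)^m - (1 - \<mu>)^m) / (2 \<mu>)\<close>.\<close>

definition gen :: "nat \<Rightarrow> (int \<Rightarrow> complex) \<Rightarrow> int \<Rightarrow> complex poly" where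
  "gen m w k = (\<Sum>l<m. smult (w (k + int l)) (up ^ (m - 1 - l) * dn ^ l))"

lemma gen_recurrence:
  assumes "w (k + int m) = w k"
  shows "up * (gen m w k - smult (w k) (gen m (\<lambda>_. 1) 0)) =
    dn * (gen m w (k + 1) - smult (w k) (gen m (\<lambda>_. 1) 0))"
proof -
  have gen: "up * gen m v k - dn * gen m v (k + 1) = smult (v k) (up ^ m - dn ^ m)"
    if "v (k + int m) = v k" for v k
    unfolding gen_def by (rule homogeneous_sum_recurrence) (rule that)
  \<comment> \<open>The constant sequence satisfies the same recurrence; \<open>w k\<close> times it
    removes the inhomogeneous term.\<close>
  have "gen m (\<lambda>_. 1) (0 + 1) = gen m (\<lambda>_. 1) 0" by (simp add: gen_def)
  then have "up * gen m (\<lambda>_. 1) 0 - dn * gen m (\<lambda>_. 1) 0 = up ^ m - dn ^ m"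
    using gen[of "\<lambda>_. 1" 0] by (metis smult_1_left)
  then have "up * gen m w k - dn * gen m w (k + 1) =
      smult (w k) (up * gen m (\<lambda>_. 1) 0 - dn * gen m (\<lambda>_. 1) 0)"
    using gen[of w k] assms by simp
  then show ?thesis
    by (simp only: right_diff_distrib smult_diff_right mult_smult_right) (simp only: algebra_simps)
qed

text \<open>\<open>up\<close> and \<open>dn\<close> are coprime, so the recurrence forces a common
  cofactor \<open>e\<close>. This makes the transports from two adjacent bottom vertices to their
  common neighbour agree.\<close>

lemma gen_quotient:
  assumes "w (k + int m) = w k"
  obtains e where "gen m w k = smult (w k) (gen m (\<lambda>_. 1) 0) + dn * e"
    "gen m w (k + 1) = smult (w k) (gen m (\<lambda>_. 1) 0) + up * e"
proof -
  define X Y where "X = gen m w k - smult (w k) (gen m (\<lambda>_. 1) 0)"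
    and "Y = gen m w (k + 1) - smult (w k) (gen m (\<lambda>_. 1) 0)"
  have XY: "up * X = dn * Y" using gen_recurrence[of w k m, OF assms] by (simp only: X_def Y_def)
  \<comment> \<open>1 is the root of \<open>dn\<close>, and \<open>up\<close> does not vanish
    there.\<close>
  then have "poly (up * X) 1 = poly (dn * Y) 1" by (rule arg_cong)
  then have "poly X 1 = 0" by simp
  then obtain e where "X = [:-1, 1:] * e" by (auto simp: poly_eq_0_iff_dvd dvd_def)
  then have X: "X = dn * (- e)" by simp
  then have "dn * (up * (- e)) = dn * Y" using XY by (simp only: ac_simps)
  then have Y: "Y = up * (- e)" by (subst (asm) mult_cancel_left) simp
  show ?thesis
  proof
    show "gen m w k = smult (w k) (gen m (\<lambda>_. 1) 0) + dn * (- e)"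
      using X unfolding X_def by (metis diff_eq_eq add.commute)
    show "gen m w (k + 1) = smult (w k) (gen m (\<lambda>_. 1) 0) + up * (- e)"
      using Y unfolding Y_def by (metis diff_eq_eq add.commute)
  qed
qed

text \<open>Every product in the sum has degree exactly \<open>m - 1\<close> and leading coefficient
  \<open>(-1) ^ l\<close>, so the alternating sum is the coefficient of degree
  \<open>m - 1\<close>.\<close>

lemma degree_less_gen:
  assumes "(\<Sum>l<m. (-1) ^ l * w (k + int l)) = 0"
  shows "degree_less (m - 1) (gen m w k)"
  unfolding degree_less_iff_coeff
proof (intro allI impI)
  fix n assume n: "m - 1 \<le> n"
  have deg: "degree (up ^ (m - 1 - l) * dn ^ l) = m - 1" if "l < m" for l
    using that by (subst degree_mult_eq) (simp_all add: degree_power_eq)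
  show "coeff (gen m w k) n = 0"
  proof (cases "n = m - 1")
    case True
    have "coeff (up ^ (m - 1 - l) * dn ^ l) n = (-1) ^ l" if "l < m" for l
    proof -
      have "lead_coeff (up ^ (m - 1 - l) * dn ^ l) = (-1) ^ l"
        by (simp only: lead_coeff_mult lead_coeff_power) simp
      then show ?thesis using deg[OF that] True by simp
    qed
    then have "coeff (gen m w k) n = (\<Sum>l<m. w (k + int l) * (-1) ^ l)"
      by (simp add: gen_def coeff_sum)
    then show ?thesis using assms by (simp add: mult.commute)
  next
    case False
    then have "coeff (up ^ (m - 1 - l) * dn ^ l) n = 0" if "l < m" for l
      using n deg[OF that] by (intro coeff_eq_0) simp
    then show ?thesis by (simp add: gen_def coeff_sum)
  qed
qed

lemma poly_gen_0: "poly (gen m w k) 0 = (\<Sum>l<m. w (k + int l))"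
  by (simp add: gen_def poly_sum)

text \<open>A flat section over the layers \<open>s\<close> (\<open>G\<close>) and \<open>s + 1\<close> (\<open>H\<close>), indexed by the first coordinate
  of the vertex.\<close>

definition flat_section ::
  "(int \<Rightarrow> int \<Rightarrow> csphere) \<Rightarrow> nat \<Rightarrow> complex \<Rightarrow> complex \<Rightarrow> nat \<Rightarrow>
    (int \<Rightarrow> complex poly \<times> complex poly) \<Rightarrow> (int \<Rightarrow> complex poly \<times> complex poly) \<Rightarrow> bool" where
  "flat_section z m x0 y0 s G H \<longleftrightarrow> (\<forall>i.
     transported dn (z i (int s - i)) (z (i + 1) (int s - i)) (G i) (H (i + 1)) \<and>
     transported up (z i (int s - i)) (z i (int s + 1 - i)) (G i) (H i) \<and>
     poly (fst (H i)) 0 = x0 \<and> poly (snd (H i)) 0 = y0 \<and>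
     degree_less (m - 1 - (s + 1) div 2) (poly_bracket (z i (int s - i)) (G i)) \<and>
     degree_less (m - 1 - (s + 2) div 2) (poly_bracket (z i (int s + 1 - i)) (H i)))"

section \<open>Propagation of the flat section by one layer\<close>

lemma flat_section_step:
  assumes flat: "flat_section z m x0 y0 s G H"
    and dh: "discrete_holomorphic_on (strip n) z" and s: "s < n"
  shows "\<exists>K. flat_section z m x0 y0 (Suc s) H K"
proof -
  have cr: "cross_ratio (z i (int s - i)) (z (i + 1) (int s - i))
      (z (i + 1) (int s + 1 - i)) (z i (int s + 1 - i)) = -1" for i
  proof -
    have "{(i, int s - i), (i + 1, int s - i), (i + 1, int s - i + 1), (i, int s - i + 1)} \<subseteq> strip n"
      using s by (auto simp: strip_def)
    then show ?thesis
      using dh unfolding discrete_holomorphic_on_def by (metis add_diff_eq diff_add_eq)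
  qed
  have "\<exists>g. transported up (z (i + 1) (int s - i)) (z (i + 1) (int s + 1 - i)) (H (i + 1)) g \<and>
      transported dn (z i (int s + 1 - i)) (z (i + 1) (int s + 1 - i)) (H i) g \<and>
      poly (fst g) 0 = x0 \<and> poly (snd g) 0 = y0" for i
  proof -
    have "dn + up = 2" by (simp add: numeral_poly)
    moreover have "transported dn (z i (int s - i)) (z (i + 1) (int s - i)) (G i) (H (i + 1))"
      "transported up (z i (int s - i)) (z i (int s + 1 - i)) (G i) (H i)"
      "poly (fst (H j)) 0 = x0" "poly (snd (H j)) 0 = y0" for j
      using flat by (simp_all add: flat_section_def)
    ultimately show ?thesis
      using transported_quad[OF cr[of i], of dn up "G i" "H (i + 1)" "H i" x0 y0] by metis
  qed
  then obtain g where g: "\<And>i. transported up (z (i + 1) (int s - i)) (z (i + 1) (int s + 1 - i)) (H (i + 1)) (g i)"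
      "\<And>i. transported dn (z i (int s + 1 - i)) (z (i + 1) (int s + 1 - i)) (H i) (g i)"
      "\<And>i. poly (fst (g i)) 0 = x0" "\<And>i. poly (snd (g i)) 0 = y0"
    by metis
  have deg: "degree_less (m - 1 - (s + 1) div 2 - 1) (poly_bracket (z (i + 1) (int s + 1 - i)) (g i))"
    for i
  proof (rule degree_less_quad[OF cr[of i] _ _ g(2)])
    show "transported up (z i (int s - i)) (z i (int s + 1 - i)) (G i) (H i)"
      "degree_less (m - 1 - (s + 1) div 2) (poly_bracket (z i (int s - i)) (G i))"
      using flat by (simp_all add: flat_section_def)
    have "degree_less (m - 1 - (s + 2) div 2) (poly_bracket (z i (int s + 1 - i)) (H i))"
      using flat by (simp add: flat_section_def)
    \<comment> \<open>The quad lemma wants one bound for both layers, so the sharper one on the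
      upper layer is relaxed.\<close>
    then show "degree_less (m - 1 - (s + 1) div 2) (poly_bracket (z i (int s + 1 - i)) (H i))"
      by (rule degree_less_mono) (intro diff_le_mono2 div_le_mono, simp)
  qed simp
  \<comment> \<open>The top corner of the quad with lowest corner at \<open>i\<close> has first
    coordinate \<open>i + 1\<close>, hence the shift.\<close>
  have "flat_section z m x0 y0 (Suc s) H (\<lambda>i. g (i - 1))"
    unfolding flat_section_def
  proof (intro allI conjI)
    fix i
    show "transported dn (z i (int (Suc s) - i)) (z (i + 1) (int (Suc s) - i)) (H i) (g (i + 1 - 1))"
      using g(2)[of i] by (simp add: ac_simps)
    show "transported up (z i (int (Suc s) - i)) (z i (int (Suc s) + 1 - i)) (H i) (g (i - 1))"
      using g(1)[of "i - 1"] by (simp add: algebra_simps)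
    show "degree_less (m - 1 - (Suc s + 1) div 2) (poly_bracket (z i (int (Suc s) - i)) (H i))"
      using flat by (simp add: flat_section_def ac_simps)
    show "degree_less (m - 1 - (Suc s + 2) div 2) (poly_bracket (z i (int (Suc s) + 1 - i)) (g (i - 1)))"
      using deg[of "i - 1"] by (simp add: algebra_simps)
  qed (simp_all add: g)
  then show ?thesis by blast
qed

section \<open>The explicit flat section over the constant bottom layer\<close>

lemma hom_coords_nonzero:
  assumes "p \<noteq> Fin 0"
  obtains c where "c \<noteq> 0" "hom_coords p = (c, c * fin_part (inv_hat p))"
  using assms by (cases p) auto

lemma flat_section_base:
  assumes m: "even m" and z0: "\<And>i. z i (- i) = Fin 0" and z1: "\<And>i. z i (1 - i) \<noteq> Fin 0"
    and w: "\<And>k. w k = fin_part (inv_hat (z (k + 1) (- k)))"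
    and per: "\<And>k. w (k + int m) = w k"
    and alt: "(\<Sum>l<m. (-1) ^ l * w (int l)) = 0"
  shows "\<exists>G H. flat_section z m (of_nat m) (\<Sum>l<m. w (int l)) 0 G H"
proof -
  define D where "D = gen m (\<lambda>_. 1) 0"
  let ?S = "\<Sum>l<m. w (int l)"
  have r0: "poly (gen m w k) 0 = ?S" for k
    unfolding poly_gen_0 by (rule sum_shift_periodic) (rule per)
  have D0: "poly D 0 = of_nat m" by (simp add: D_def poly_gen_0)
  have altk: "(\<Sum>l<m. (-1) ^ l * w (k + int l)) = 0" for k
  proof -
    \<comment> \<open>As \<open>m\<close> is even, the sequence with alternating signs is still
      \<open>m\<close>-periodic, so its vanishing sum does not depend on the starting index.\<close>
    define f where "f j = (if even j then w j else - w j)" for j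
    have "f (k + int m) = f k" for k using m per by (simp add: f_def)
    then have "(\<Sum>l<m. f (k + int l)) = (\<Sum>l<m. f (int l))" by (rule sum_shift_periodic)
    moreover have "f (int l) = (-1) ^ l * w (int l)" for l by (simp add: f_def)
    ultimately have "(\<Sum>l<m. f (k + int l)) = 0" using alt by simp
    moreover have "(-1) ^ l * w (k + int l) = (if even k then 1 else -1) * f (k + int l)" for l
      by (simp add: f_def)
    ultimately show ?thesis by (simp only: sum_distrib_left[symmetric]) simp
  qed
  have degr: "degree_less (m - 1) (gen m w k)" for k
    by (rule degree_less_gen) (rule altk)
  have degD: "degree_less (m - 1) D"
    unfolding D_def
  proof (rule degree_less_gen)
    from m obtain q where "m = 2 * q" by (auto elim: evenE)
    moreover have "(\<Sum>l<2 * q. (-1) ^ l * 1) = (0::complex)" by (induction q) simp_all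
    ultimately show "(\<Sum>l<m. (-1) ^ l * (\<lambda>_. 1) (0 + int l)) = (0::complex)" by simp
  qed
  have "\<exists>e. gen m w k = smult (w k) D + dn * e \<and> gen m w (k + 1) = smult (w k) D + up * e" for k
    using gen_quotient[of w k m, OF per] unfolding D_def by metis
  then obtain e where e: "\<And>k. gen m w k = smult (w k) D + dn * e k"
    "\<And>k. gen m w (k + 1) = smult (w k) D + up * e k"
    by metis
  have e0: "poly (smult (w k) D + e k) 0 = ?S" for k
    using arg_cong[OF e(1)[of k], of "\<lambda>p. poly p 0"] r0[of k] by simp
  have dege: "degree_less (m - 2) (e k)" for k
  proof -
    have "degree_less (m - 1) (gen m w k - smult (w k) D)"
      by (intro degree_less_diff degree_less_smult degr degD)
    also have "gen m w k - smult (w k) D = dn * e k" using e(1) by simp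
    finally have "degree_less (m - 1 - 1) (e k)" by (rule degree_less_cancel_mult) simp
    then show ?thesis by (simp add: numeral_2_eq_2)
  qed
  define G where "G = (\<lambda>k. (D, gen m w k))"
  \<comment> \<open>Transport from the point 0 preserves the first component, so it is
    \<open>D\<close> on both layers. The second is chosen so that the bracket with the vertex
    becomes a multiple of \<open>e\<close>, which is the bracket of \<open>G\<close> with the factor
    \<open>dn\<close> or \<open>up\<close> removed.\<close>
  define H where "H = (\<lambda>k. (D, smult (w (k - 1)) D + e (k - 1)))"
  have brH: "\<exists>c. poly_bracket (z i (1 - i)) (H i) = smult c (e (i - 1)) \<and>
     poly_bracket (z i (1 - i)) (G (i - 1)) = dn * smult c (e (i - 1)) \<and>
     poly_bracket (z i (1 - i)) (G i) = up * smult c (e (i - 1))" for i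
  proof -
    obtain c where "hom_coords (z i (1 - i)) = (c, c * w (i - 1))"
      using hom_coords_nonzero[OF z1[of i]] w[of "i - 1"] by auto
    then show ?thesis
      using e(1)[of "i - 1"] e(2)[of "i - 1"]
      by (intro exI[of _ c]) (simp add: poly_bracket_def G_def H_def smult_add_right)
  qed
  have br0: "poly_bracket (z i (- i)) (G i) = - D" "poly_bracket (z i (- i)) (H j) = - D" for i j
    by (simp_all add: poly_bracket_def z0 G_def H_def)
  have "flat_section z m (of_nat m) ?S 0 G H"
    unfolding flat_section_def
  proof (intro allI conjI)
    fix i
    show "transported dn (z i (int 0 - i)) (z (i + 1) (int 0 - i)) (G i) (H (i + 1))"
      using brH[of "i + 1"] br0 by (auto simp: transported_def smult_add_right)
    show "transported up (z i (int 0 - i)) (z i (int 0 + 1 - i)) (G i) (H i)"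
      using brH[of i] br0 by (auto simp: transported_def smult_add_right)
    show "poly (fst (H i)) 0 = of_nat m" "poly (snd (H i)) 0 = ?S"
      using D0 e0[of "i - 1"] by (simp_all add: H_def)
    show "degree_less (m - 1 - (0 + 1) div 2) (poly_bracket (z i (int 0 - i)) (G i))"
      using br0 degD by (simp add: degree_less_def)
    show "degree_less (m - 1 - (0 + 2) div 2) (poly_bracket (z i (int 0 + 1 - i)) (H i))"
      using brH[of i] dege[of "i - 1"] by (auto intro: degree_less_smult simp: numeral_2_eq_2)
  qed
  then show ?thesis by blast
qed

section \<open>Evaluation on layer \<open>2 * m - 3\<close>\<close>

theorem theorem6p12:
  fixes m n :: nat and z :: "int \<Rightarrow> int \<Rightarrow> csphere"
  assumes "m \<ge> 2" and "even m"
    and "n \<ge> 2 * m - 4"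
    and "discrete_holomorphic_on (strip n) z"
    and "closed_on (strip n) m z"
    and "propagation_applicable n (layer_of z 0, layer_of z 1)"
    and "\<forall>i. even i \<longrightarrow> rotated z i 0 = Fin 0"
    and "\<forall>i. odd i \<longrightarrow> rotated z i 1 \<noteq> Fin 0"
    and "(\<Sum>i<m. (-1) ^ i * fin_part (inv_hat (rotated z (2 * int i + 1) 1))) = 0"
  shows "\<forall>i. odd i \<longrightarrow> rotated z i (2 * int m - 3) =
    inv_hat (Fin (1 / of_nat m * (\<Sum>l<m. fin_part (inv_hat (rotated z (2 * int l + 1) 1)))))"
proof (intro allI impI)
  fix i :: int
  assume "odd i"
  define w where "w k = fin_part (inv_hat (z (k + 1) (- k)))" for k
  define S where "S = (\<Sum>l<m. w (int l))"
  have rot1: "rotated z (2 * k + 1) 1 = z (k + 1) (- k)" for k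
    using rotated_diff_sum[of z "k + 1" "- k"] by (simp add: algebra_simps)
  have z0: "z k (- k) = Fin 0" for k
    using assms(7) rotated_diff_sum[of z k "- k"] by simp
  have z1: "z k (1 - k) \<noteq> Fin 0" for k
  proof -
    have "rotated z (2 * (k - 1) + 1) 1 \<noteq> Fin 0" using assms(8) by simp
    then show ?thesis using rot1[of "k - 1"] by simp
  qed
  have per: "w (k + int m) = w k" for k
  proof -
    have "(k + 1, - k) \<in> strip n" by (simp add: strip_def)
    then have "z (k + 1 + int m) (- k - int m) = z (k + 1) (- k)"
      using assms(5) by (auto simp: closed_on_def)
    then show ?thesis by (simp add: w_def ac_simps)
  qed
  have ex: "\<exists>G H. flat_section z m (of_nat m) S s G H" if "s \<le> n" for s
    using that
  proof (induction s)
    case 0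
    show ?case unfolding S_def
      by (rule flat_section_base) (use assms z0 z1 per in \<open>auto simp: w_def rot1\<close>)
  next
    case (Suc s)
    then show ?case using flat_section_step[OF _ assms(4)] by (meson Suc_le_eq less_imp_le)
  qed
  \<comment> \<open>Back to the original coordinates: the vertex with difference \<open>i\<close>
    and sum \<open>2 * m - 3\<close>; the division is exact because \<open>i\<close> is odd.\<close>
  define a where "a = (i + 2 * int m - 3) div 2"
  define v where "v = z a (2 * int m - 3 - a)"
  have s: "int (2 * m - 4) = 2 * int m - 4" using assms(1) by simp
  have a: "i + 2 * int m - 3 = 2 * a" using \<open>odd i\<close> by (simp add: a_def)
  have "a - (2 * int m - 3 - a) = i" "a + (2 * int m - 3 - a) = 2 * int m - 3" using a by simp_all
  then have v: "rotated z i (2 * int m - 3) = v"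
    using rotated_diff_sum[of z a "2 * int m - 3 - a"] by (simp add: v_def)
  obtain G H where "flat_section z m (of_nat m) S (2 * m - 4) G H"
    using ex assms(3) by blast
  then have "poly (fst (H a)) 0 = of_nat m" "poly (snd (H a)) 0 = S"
    "degree_less (m - 1 - (2 * m - 4 + 2) div 2) (poly_bracket v (H a))"
    using s by (simp_all add: flat_section_def v_def algebra_simps)
  \<comment> \<open>The degree bound has reached 0, so the bracket is the zero polynomial.\<close>
  moreover have "m - 1 - (2 * m - 4 + 2) div 2 = 0" using assms(1) by simp
  ultimately have "poly (poly_bracket v (H a)) 0 = 0" and
      H0: "poly (fst (H a)) 0 = of_nat m" "poly (snd (H a)) 0 = S"
    by (simp_all add: degree_less_def)
  then have "fst (hom_coords v) * S = snd (hom_coords v) * of_nat m"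
    by (simp add: poly_poly_bracket)
  \<comment> \<open>\<open>v\<close> is the point with homogeneous coordinates
    \<open>(m, S)\<close>; it is \<open>Infty\<close> exactly when \<open>S = 0\<close>, which
    \<open>inv_hat\<close> covers.\<close>
  then have "v = inv_hat (Fin (1 / of_nat m * S))"
    using assms(1) by (cases v) (auto simp: field_simps)
  then show "rotated z i (2 * int m - 3) =
      inv_hat (Fin (1 / of_nat m * (\<Sum>l<m. fin_part (inv_hat (rotated z (2 * int l + 1) 1)))))"
    by (simp add: v S_def w_def rot1)
qed

end
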